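(* Let $\alpha>0$, $\alpha\neq1$, and let $\mathscr{E}^{(\alpha)}=\{p_\theta:\theta\in\Theta\}$ be an $\alpha$-exponential family characterized by $h,w,f,\Theta$, all of whose members have a common support $\mathbb{S}$. In the discrete case ($\mathbb{S}$ discrete), let $g=p_n$ be the empirical distribution of the sample, with no further condition. In the continuous case, let $g=\widetilde p_n$ be a continuous estimate of $p_n$, used in place of $p_n$ in both estimation problems, and assume $\int\nabla[p_\theta(\mathbf{x})]\,d\mathbf{x}=0$. Then solving the generalized Hellinger estimation problem under the $\mathscr{E}^{(\alpha)}$-family is equivalent to solving the Jones et al. estimation problem under the $\mathbb{M}^{(1/\alpha)}$-family characterized by the same entities $h,w,f,\Theta,\mathbb{S}$; that is, $\{p_\theta^{(\alpha)}:\theta\in\Theta\}$ is this $\mathbb{M}^{(1/\alpha)}$-family, and the generalized Hellinger estimating equation of order $\alpha$ for $\{p_\theta\}$ and $g$ is the same as the Jones et al. estimating equation of order $1/\alpha$ for $\{p_\theta^{(\alpha)}\}$ and $g^{(\alpha)}$.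
   Context: Integrals are over $\mathbb{S}\subseteq\mathbb{R}^d$ with respect to Lebesgue measure (continuous case) or counting measure, i.e. sums (discrete case); all integrals are assumed well defined and the indicated derivatives to exist. $\nabla$ is the gradient in $\theta\in\Theta$, with $\Theta\subset\mathbb{R}^k$ open. The sample points lie in $\mathbb{S}$. For a probability distribution (density) $p$ on $\mathbb{S}$, $p^{(\alpha)}=p^\alpha/\int p^\alpha$ (the $\alpha$-scaled or escort measure). For a family $\{p_\theta\}$ with common support $\mathbb{S}$ and score $s(\mathbf{x};\theta)=\nabla\ln p_\theta(\mathbf{x})$, and a probability distribution $g$ on $\mathbb{S}$: - the generalized Hellinger estimating equation of order $\alpha$ is $\int g(\mathbf{x})^\alpha p_\theta(\mathbf{x})^{1-\alpha}s(\mathbf{x};\theta)\,d\mathbf{x}=0$; - the Jones et al. estimating equation of order $\gamma$ is $\dfrac{\int g\,p_\theta^{\gamma-1}s(\cdot;\theta)}{\int g\,p_\theta^{\gamma-1}}=\dfrac{\int p_\theta^{\gamma}s(\cdot;\theta)}{\int p_\theta^\gamma}$. Families, for $w=[w_1,\dots,w_s]^\top$ with $w_i:\Theta\to\mathbb{R}$ differentiable, $f=[f_1,\dots,f_s]^\top$, and $f_i,h:\mathbb{R}^d\to\mathbb{R}$: $\{p_\theta\}$ is an $\mathscr{E}^{(\alpha)}$-family ($\alpha$-exponential family) characterized by $h,w,f,\Theta,\mathbb{S}$ if $p_\theta=Z(\theta)[h+w(\theta)^\top f]^{1/(1-\alpha)}$ on $\mathbb{S}$ and $0$ elsewhere, with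 $Z:\Theta\to\mathbb{R}$ a differentiable normalizing factor; it is an $\mathbb{M}^{(\gamma)}$-family characterized by $h,w,f,\Theta,\mathbb{S}$ if $p_\theta=Z(\theta)[h+w(\theta)^\top f]^{1/(\gamma-1)}$ on $\mathbb{S}$ and $0$ elsewhere, with $Z:\Theta\to\mathbb{R}$ a differentiable normalizing factor.
   Formalization: In the discrete case with infinite S and α>1, "no further condition" fails in general; here the sums over S of p_θ'(x)^α p_θ(x)^(1-α) are additionally assumed finite for all θ, θ' in Θ. *)

theory Defs
  imports "HOL-Analysis.Analysis"
begin

text \<open>
  Throughout, \<open>M\<close> is the reference measure and its space is the set \<open>S\<close> of the model:
  \<open>count_space S\<close> in the discrete case, \<open>lebesgue_on S\<close> in the continuous case.  Distributions are
  identified with their densities, extended by zero outside \<open>S\<close>.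
\<close>

definition prob_density_on :: "'x measure \<Rightarrow> ('x \<Rightarrow> real) \<Rightarrow> bool" where
  "prob_density_on M p \<longleftrightarrow>
     (\<forall>x. 0 \<le> p x) \<and> (\<forall>x. x \<notin> space M \<longrightarrow> p x = 0) \<and> has_bochner_integral M p 1"

definition empirical :: "nat \<Rightarrow> (nat \<Rightarrow> 'x) \<Rightarrow> 'x \<Rightarrow> real" where
  "empirical n X x = real (card {i. i < n \<and> X i = x}) / real n"

definition escort :: "'x measure \<Rightarrow> real \<Rightarrow> ('x \<Rightarrow> real) \<Rightarrow> 'x \<Rightarrow> real" where
  "escort M \<alpha> p x = p x powr \<alpha> / (\<integral>y. p y powr \<alpha> \<partial>M)"

definition escort_defined :: "'x measure \<Rightarrow> real \<Rightarrow> ('x \<Rightarrow> real) \<Rightarrow> bool" where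
  "escort_defined M \<alpha> p \<longleftrightarrow> integrable M (\<lambda>x. p x powr \<alpha>)"

definition grad :: "('t::real_inner \<Rightarrow> real) \<Rightarrow> 't \<Rightarrow> 't" where
  "grad F t = (THE D. GDERIV F t :> D)"

definition score :: "('t::real_inner \<Rightarrow> 'x \<Rightarrow> real) \<Rightarrow> 't \<Rightarrow> 'x \<Rightarrow> 't" where
  "score p \<theta> x = grad (\<lambda>t. ln (p t x)) \<theta>"

definition score_defined ::
  "'x measure \<Rightarrow> ('t::real_inner \<Rightarrow> 'x \<Rightarrow> real) \<Rightarrow> 't \<Rightarrow> bool" where
  "score_defined M p \<theta> \<longleftrightarrow> (\<forall>x\<in>space M. (\<lambda>t. ln (p t x)) differentiable (at \<theta>))"


definition hellinger_defined ::
  "'x measure \<Rightarrow> real \<Rightarrow> (real^'k \<Rightarrow> 'x \<Rightarrow> real) \<Rightarrow> ('x \<Rightarrow> real) \<Rightarrow> real^'k \<Rightarrow> bool" where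
  "hellinger_defined M \<alpha> p g \<theta> \<longleftrightarrow>
     score_defined M p \<theta> \<and>
     integrable M (\<lambda>x. (g x powr \<alpha> * p \<theta> x powr (1 - \<alpha>)) *\<^sub>R score p \<theta> x)"

definition hellinger_equation ::
  "'x measure \<Rightarrow> real \<Rightarrow> (real^'k \<Rightarrow> 'x \<Rightarrow> real) \<Rightarrow> ('x \<Rightarrow> real) \<Rightarrow> real^'k \<Rightarrow> bool" where
  "hellinger_equation M \<alpha> p g \<theta> \<longleftrightarrow>
     (\<integral>x. (g x powr \<alpha> * p \<theta> x powr (1 - \<alpha>)) *\<^sub>R score p \<theta> x \<partial>M) = 0"

definition jones_defined ::
  "'x measure \<Rightarrow> real \<Rightarrow> (real^'k \<Rightarrow> 'x \<Rightarrow> real) \<Rightarrow> ('x \<Rightarrow> real) \<Rightarrow> real^'k \<Rightarrow> bool" where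
  "jones_defined M \<gamma> p g \<theta> \<longleftrightarrow>
     score_defined M p \<theta> \<and>
     integrable M (\<lambda>x. (g x * p \<theta> x powr (\<gamma> - 1)) *\<^sub>R score p \<theta> x) \<and>
     integrable M (\<lambda>x. g x * p \<theta> x powr (\<gamma> - 1)) \<and>
     integrable M (\<lambda>x. p \<theta> x powr \<gamma> *\<^sub>R score p \<theta> x) \<and>
     integrable M (\<lambda>x. p \<theta> x powr \<gamma>)"

definition jones_equation ::
  "'x measure \<Rightarrow> real \<Rightarrow> (real^'k \<Rightarrow> 'x \<Rightarrow> real) \<Rightarrow> ('x \<Rightarrow> real) \<Rightarrow> real^'k \<Rightarrow> bool" where
  "jones_equation M \<gamma> p g \<theta> \<longleftrightarrow>
     (\<integral>x. (g x * p \<theta> x powr (\<gamma> - 1)) *\<^sub>R score p \<theta> x \<partial>M)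
        /\<^sub>R (\<integral>x. g x * p \<theta> x powr (\<gamma> - 1) \<partial>M)
   = (\<integral>x. p \<theta> x powr \<gamma> *\<^sub>R score p \<theta> x \<partial>M) /\<^sub>R (\<integral>x. p \<theta> x powr \<gamma> \<partial>M)"


text \<open>
  The common shape of both kinds of families, with exponent \<open>r\<close>.  The base \<open>h x + w \<theta> \<bullet> f x\<close> is
  required to be positive on \<open>S\<close> since it is raised to an arbitrary real power.
\<close>

definition power_family ::
  "'x measure \<Rightarrow> real \<Rightarrow> ('x \<Rightarrow> real) \<Rightarrow> (real^'k \<Rightarrow> real^'s) \<Rightarrow> ('x \<Rightarrow> real^'s) \<Rightarrow> (real^'k) set \<Rightarrow>
   (real^'k \<Rightarrow> 'x \<Rightarrow> real) \<Rightarrow> bool" where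
  "power_family M r h w f \<Theta> p \<longleftrightarrow>
     (\<forall>\<theta>\<in>\<Theta>. w differentiable (at \<theta>)) \<and>
     (\<forall>\<theta>\<in>\<Theta>. prob_density_on M (p \<theta>)) \<and>
     (\<forall>\<theta>\<in>\<Theta>. \<forall>x\<in>space M. 0 < h x + w \<theta> \<bullet> f x) \<and>
     (\<exists>Z :: real^'k \<Rightarrow> real.
        (\<forall>\<theta>\<in>\<Theta>. Z differentiable (at \<theta>)) \<and>
        (\<forall>\<theta>\<in>\<Theta>. \<forall>x. p \<theta> x =
           (if x \<in> space M then Z \<theta> * (h x + w \<theta> \<bullet> f x) powr r else 0)))"

definition alpha_exponential_family ::
  "'x measure \<Rightarrow> real \<Rightarrow> ('x \<Rightarrow> real) \<Rightarrow> (real^'k \<Rightarrow> real^'s) \<Rightarrow> ('x \<Rightarrow> real^'s) \<Rightarrow> (real^'k) set \<Rightarrow>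
   (real^'k \<Rightarrow> 'x \<Rightarrow> real) \<Rightarrow> bool" where
  "alpha_exponential_family M \<alpha> = power_family M (1 / (1 - \<alpha>))"

definition M_family ::
  "'x measure \<Rightarrow> real \<Rightarrow> ('x \<Rightarrow> real) \<Rightarrow> (real^'k \<Rightarrow> real^'s) \<Rightarrow> ('x \<Rightarrow> real^'s) \<Rightarrow> (real^'k) set \<Rightarrow>
   (real^'k \<Rightarrow> 'x \<Rightarrow> real) \<Rightarrow> bool" where
  "M_family M \<gamma> = power_family M (1 / (\<gamma> - 1))"


text \<open>
  The integrals \<open>\<integral> g\<^sup>\<alpha> p\<^sub>\<theta>\<^sup>1\<^sup>-\<^sup>\<alpha>\<close> with \<open>g\<close> itself a member of the model.  They are automatically
  finite if \<open>S\<close> is finite, or if \<open>\<alpha> < 1\<close> (Hoelder).  For \<open>\<alpha> > 1\<close> and infinite discrete \<open>S\<close> they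
  can diverge, and then \<open>\<Sum>\<^sub>x \<nabla>p\<^sub>\<theta>(x)\<close> may converge absolutely without being zero.
\<close>

definition mutual_integrals_defined ::
  "'x measure \<Rightarrow> real \<Rightarrow> ('t \<Rightarrow> 'x \<Rightarrow> real) \<Rightarrow> 't set \<Rightarrow> bool" where
  "mutual_integrals_defined M \<alpha> p \<Theta> \<longleftrightarrow>
     (\<forall>\<theta>\<in>\<Theta>. \<forall>\<theta>'\<in>\<Theta>. integrable M (\<lambda>x. p \<theta>' x powr \<alpha> * p \<theta> x powr (1 - \<alpha>)))"

end

theory Submission
  imports Defs
begin

text \<open>
  Put \<open>N \<theta> = \<integral> p\<^sub>\<theta>\<^sup>\<alpha>\<close>.  The score of \<open>p\<^sub>\<theta>\<^sup>(\<^sup>\<alpha>\<^sup>)\<close> is \<open>\<alpha>\<close> times the score of \<open>p\<^sub>\<theta>\<close> minus the constant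
  vector \<open>\<nabla> ln N\<close>.  This constant cancels from the Jones et al. equation, which thus becomes
  \<open>\<integral> g\<^sup>\<alpha> p\<^sub>\<theta>\<^sup>1\<^sup>-\<^sup>\<alpha> s / \<integral> g\<^sup>\<alpha> p\<^sub>\<theta>\<^sup>1\<^sup>-\<^sup>\<alpha> = \<integral> p\<^sub>\<theta> s = \<integral> \<nabla>p\<^sub>\<theta>\<close>; its right-hand side vanishes.

  In the discrete case \<open>\<integral> \<nabla>p\<^sub>\<theta> = 0\<close> has to be proved, without a dominating function.  Let
  \<open>B\<^sub>\<theta> = h + w(\<theta>)\<^sup>T f\<close> and \<open>r = 1 / (1 - \<alpha>)\<close>, so that \<open>r > 1\<close> or \<open>r < 0\<close> and \<open>y\<^sup>r\<close> is convex.
  Integrating the tangent inequality at \<open>B\<^sub>\<theta>\<close> gives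
  \<open>\<integral> B\<^sub>t\<^sup>r - \<integral> B\<^sub>\<theta>\<^sup>r \<ge> r L (w t - w \<theta>)\<close> with \<open>L v = \<integral> B\<^sub>\<theta>\<^sup>r\<^sup>-\<^sup>1 (v \<bullet> f)\<close>, which is linear on the
  subspace where it is defined.  Both sides are differentiable in \<open>t\<close> and agree at \<open>t = \<theta>\<close>, hence
  so do their derivatives there, and this is differentiation under the integral sign.
\<close>

section \<open>Gradients as representers of derivatives\<close>

lemma GDERIV_imp_grad_eq:
  assumes "GDERIV F x :> D"
  shows "grad F x = D"
  unfolding grad_def
proof (rule the_equality)
  fix E assume "GDERIV F x :> E"
  then have "(\<lambda>h. inner h E) = (\<lambda>h. inner h D)"
    using assms has_derivative_unique unfolding gderiv_def by blast
  then have "inner (E - D) E = inner (E - D) D" by metis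
  then show "E = D" by (metis inner_diff_right inner_eq_zero_iff right_minus_eq)
qed (rule assms)

text \<open>\<open>grad\<close> is a definite description, so it carries information only once a
  representing vector exists. In a Euclidean space the Riesz representer of the derivative has the
  values on the basis as its coordinates.\<close>

lemma differentiable_imp_GDERIV_grad:
  fixes F :: "'a::euclidean_space \<Rightarrow> real"
  assumes "F differentiable (at x)"
  shows "GDERIV F x :> grad F x"
proof -
  obtain F' where F': "(F has_derivative F') (at x)"
    using assms by (auto simp: differentiable_def)
  interpret F': bounded_linear F' by (rule has_derivative_bounded_linear[OF F'])
  define D where "D = (\<Sum>b\<in>Basis. F' b *\<^sub>R b)"
  have "F' h = inner h D" for h
  proof -
    have "F' h = F' (\<Sum>b\<in>Basis. (h \<bullet> b) *\<^sub>R b)" by (simp add: euclidean_representation)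
    also have "\<dots> = inner h D"
      unfolding D_def F'.sum F'.scaleR inner_sum_right by (simp add: mult.commute)
    finally show ?thesis .
  qed
  then have "GDERIV F x :> D" using F' unfolding gderiv_def by presburger
  then show ?thesis using GDERIV_imp_grad_eq by metis
qed

lemma GDERIV_cong_open:
  assumes "GDERIV F x :> D" "open T" "x \<in> T" "\<And>t. t \<in> T \<Longrightarrow> F t = G t"
  shows "GDERIV G x :> D"
  using assms has_derivative_transform_within_open unfolding gderiv_def by blast

section \<open>Inequalities for real powers\<close>

lemma powr_above_tangent:
  fixes x y r :: real
  assumes "0 < x" "0 < y" "1 \<le> r \<or> r \<le> 0"
  shows "r * x powr (r - 1) * (y - x) \<le> y powr r - x powr r"
proof -
  \<comment> \<open>This coefficient of the second derivative is nonnegative exactly for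
    \<open>r\<close> outside the open interval from 0 to 1, which is where the power is
    convex.\<close>
  have "0 \<le> r * (r - 1)"
    using assms(3) by (auto simp: zero_le_mult_iff)
  have "convex_on {0<..} (\<lambda>x. x powr r)"
  proof (rule f''_ge0_imp_convex)
    fix z :: real assume z: "z \<in> {0<..}"
    then show "((\<lambda>x. x powr r) has_real_derivative r * z powr (r - 1)) (at z)"
      by (auto intro!: derivative_eq_intros)
    show "((\<lambda>x. r * x powr (r - 1)) has_real_derivative r * (r - 1) * z powr (r - 2)) (at z)"
      using z by (auto intro!: derivative_eq_intros simp: diff_diff_eq)
    show "0 \<le> r * (r - 1) * z powr (r - 2)"
      using \<open>0 \<le> r * (r - 1)\<close> by simp
  qed simp
  moreover have "((\<lambda>x. x powr r) has_real_derivative r * x powr (r - 1)) (at x within {0<..})"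
    using assms by (auto intro!: derivative_eq_intros)
  ultimately show ?thesis
    using assms convex_on_imp_above_tangent[of "{0<..}" "\<lambda>x. x powr r" x y "r * x powr (r - 1)"]
    by (simp add: interior_open convex_connected)
qed

text \<open>A crude form of the weighted AM-GM inequality: once both bases are enlarged to the
  maximum, the exponents add up to 1. It provides the dominating function for the mutual integrals
  when \<open>\<alpha> < 1\<close>.\<close>

lemma powr_mult_powr_le_add:
  fixes a b u :: real
  assumes "0 < a" "0 < b" "0 \<le> u" "u \<le> 1"
  shows "a powr u * b powr (1 - u) \<le> a + b"
proof -
  have "a powr u * b powr (1 - u) \<le> max a b powr u * max a b powr (1 - u)"
    using assms by (intro mult_mono powr_mono2) auto
  also have "\<dots> = max a b"
    using assms by (simp flip: powr_add)
  also have "\<dots> \<le> a + b" using assms by simp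
  finally show ?thesis .
qed

section \<open>Differentiation under the integral sign by convexity\<close>

text \<open>Difference quotients of \<open>w\<close> at \<open>x\<close> lie in \<open>V\<close>,
  and a subspace of a Euclidean space is closed, so it contains their limits. This passes
  integrability from increments of \<open>w\<close> to the directions \<open>w' v\<close>.\<close>

lemma subspace_derivative_range:
  fixes w :: "'a::real_normed_vector \<Rightarrow> 'b::euclidean_space"
  assumes w': "(w has_derivative w') (at x)"
    and "open T" "x \<in> T" "subspace V" "\<And>t. t \<in> T \<Longrightarrow> w t - w x \<in> V"
  shows "w' v \<in> V"
proof -
  have lim: "((\<lambda>s. (w (x + s *\<^sub>R v) - w x) /\<^sub>R s) \<longlongrightarrow> w' v) (at 0)"
  proof -
    have l: "((\<lambda>s. x + s *\<^sub>R v) has_derivative (\<lambda>s. s *\<^sub>R v)) (at 0)"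
      by (auto intro!: derivative_eq_intros)
    have "((\<lambda>s. w (x + s *\<^sub>R v)) has_derivative (\<lambda>s. w' (s *\<^sub>R v))) (at 0)"
      by (rule has_derivative_compose[OF l]) (simp add: w')
    then have "((\<lambda>s. w (x + s *\<^sub>R v)) has_vector_derivative w' v) (at 0)"
      unfolding has_vector_derivative_def
      by (simp add: linear_simps(5)[OF has_derivative_bounded_linear[OF w']])
    then have "((\<lambda>s. norm (w (x + s *\<^sub>R v) - w x - s *\<^sub>R w' v) / norm s) \<longlongrightarrow> 0) (at 0)"
      unfolding has_vector_derivative_def has_derivative_at by simp
    moreover have "\<forall>\<^sub>F s in at 0. norm (w (x + s *\<^sub>R v) - w x - s *\<^sub>R w' v) / norm s
        = norm ((w (x + s *\<^sub>R v) - w x) /\<^sub>R s - w' v)"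
      \<comment> \<open>Only \<open>s\<close> being nonzero is taken from this; the radius of the
        ball is immaterial.\<close>
      using eventually_at_ball'[OF zero_less_one]
    proof eventually_elim
      case (elim s)
      then have "(w (x + s *\<^sub>R v) - w x) /\<^sub>R s - w' v = (w (x + s *\<^sub>R v) - w x - s *\<^sub>R w' v) /\<^sub>R s"
        by (simp add: scaleR_diff_right)
      then show ?case by (simp add: divide_inverse_commute)
    qed
    ultimately have "((\<lambda>s. norm ((w (x + s *\<^sub>R v) - w x) /\<^sub>R s - w' v)) \<longlongrightarrow> 0) (at 0)"
      by (rule Lim_transform_eventually)
    then show ?thesis
      by (simp add: tendsto_norm_zero_iff flip: LIM_zero_iff[of _ "w' v"])
  qed
  have "\<forall>\<^sub>F s in at 0. x + s *\<^sub>R v \<in> T"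
    by (rule topological_tendstoD[OF _ \<open>open T\<close>])
       (use \<open>x \<in> T\<close> in \<open>auto intro!: tendsto_eq_intros\<close>)
  then have "\<forall>\<^sub>F s in at 0. (w (x + s *\<^sub>R v) - w x) /\<^sub>R s \<in> V"
    by eventually_elim (use assms in \<open>simp add: subspace_scale\<close>)
  then show ?thesis
    by (rule Lim_in_closed_set[OF closed_subspace[OF \<open>subspace V\<close>]]) (use lim in auto)
qed

text \<open>The hypothesis \<open>mixed\<close> makes the integral of the tangent inequality
  meaningful at every \<open>t\<close>; it stands in for a dominating function. Differentiability of
  the integral is an input, and the content is the value of its derivative.\<close>

lemma integral_powr_affine_derivative:
  fixes h :: "'x \<Rightarrow> real" and w :: "'t::euclidean_space \<Rightarrow> 'b::euclidean_space" and f :: "'x \<Rightarrow> 'b"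
  defines "B \<equiv> \<lambda>t x. h x + w t \<bullet> f x"
  assumes r: "1 \<le> r \<or> r \<le> 0"
    and "open T" "\<theta> \<in> T"
    and pos: "\<And>t x. t \<in> T \<Longrightarrow> x \<in> space M \<Longrightarrow> 0 < B t x"
    and int: "\<And>t. t \<in> T \<Longrightarrow> integrable M (\<lambda>x. B t x powr r)"
    and mixed: "\<And>t. t \<in> T \<Longrightarrow> integrable M (\<lambda>x. B \<theta> x powr (r - 1) * B t x)"
    and w': "(w has_derivative w') (at \<theta>)"
    and F': "((\<lambda>t. \<integral>x. B t x powr r \<partial>M) has_derivative F') (at \<theta>)"
  shows "integrable M (\<lambda>x. B \<theta> x powr (r - 1) * (w' v \<bullet> f x))"
    and "F' v = r * (\<integral>x. B \<theta> x powr (r - 1) * (w' v \<bullet> f x) \<partial>M)"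
proof -
  define V where "V = {v. integrable M (\<lambda>x. B \<theta> x powr (r - 1) * (v \<bullet> f x))}"
  define L where "L v = (\<integral>x. B \<theta> x powr (r - 1) * (v \<bullet> f x) \<partial>M)" for v
  have V: "subspace V"
    unfolding V_def subspace_def by (auto simp: inner_add_left distrib_left mult.left_commute)
  have diff_V: "w t - w \<theta> \<in> V" if "t \<in> T" for t
  proof -
    \<comment> \<open>The difference cancels \<open>h\<close> and leaves the increment
      \<open>w t - w \<theta>\<close> paired with \<open>f\<close>.\<close>
    have "integrable M (\<lambda>x. B \<theta> x powr (r - 1) * B t x - B \<theta> x powr (r - 1) * B \<theta> x)"
      using mixed \<open>\<theta> \<in> T\<close> that by auto
    then show ?thesis
      unfolding V_def B_def by (simp add: algebra_simps)
  qed
  show int': "integrable M (\<lambda>x. B \<theta> x powr (r - 1) * (w' v \<bullet> f x))" for v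
    using subspace_derivative_range[OF w' \<open>open T\<close> \<open>\<theta> \<in> T\<close> V diff_V] by (auto simp: V_def)
  \<comment> \<open>Outside \<open>V\<close> the integral in \<open>L\<close> takes its default
    value 0, so \<open>L\<close> need not be linear on the whole space. Composing it with a linear
    projection onto \<open>V\<close> gives an everywhere linear map, bounded by finite dimension,
    that agrees with \<open>L\<close> on \<open>V\<close>.\<close>
  obtain P where P: "linear P" "range P \<subseteq> V" "\<And>v. v \<in> V \<Longrightarrow> P v = v"
    using linear_exists_left_inverse_on[OF linear_id V] by auto
  have PV: "P v \<in> V" for v using P by auto
  have "linear (\<lambda>v. L (P v))"
  proof (rule linearI)
    show "L (P (u + v)) = L (P u) + L (P v)" for u v
      unfolding linear_add[OF P(1)] L_def inner_add_left distrib_left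
      using PV[of u] PV[of v] by (intro Bochner_Integration.integral_add) (auto simp: V_def)
    show "L (P (c *\<^sub>R v)) = c *\<^sub>R L (P v)" for c v
      unfolding linear_scale[OF P(1)] L_def by (simp add: mult.left_commute)
  qed
  then have LP: "bounded_linear (\<lambda>v. L (P v))"
    by (rule linear_conv_bounded_linear[THEN iffD1])
  \<comment> \<open>The gap between the integral and its tangent functional: it is differentiable
    and minimal over \<open>T\<close> at \<open>\<theta>\<close>, so its derivative there is
    zero.\<close>
  let ?\<phi> = "\<lambda>t. (\<integral>x. B t x powr r \<partial>M) - r * L (P (w t - w \<theta>))"
  have "((\<lambda>t. w t - w \<theta>) has_derivative w') (at \<theta>)"
    by (auto intro!: derivative_eq_intros w')
  then have "(?\<phi> has_derivative (\<lambda>v. F' v - r * L (P (w' v)))) (at \<theta>)"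
    by (intro has_derivative_diff F' has_derivative_mult_right bounded_linear.has_derivative[OF LP])
  moreover have "?\<phi> \<theta> \<le> ?\<phi> t" if "t \<in> T" for t
  proof -
    have "r * L (w t - w \<theta>) = (\<integral>x. r * (B \<theta> x powr (r - 1) * ((w t - w \<theta>) \<bullet> f x)) \<partial>M)"
      by (simp add: L_def)
    also have "\<dots> \<le> (\<integral>x. B t x powr r - B \<theta> x powr r \<partial>M)"
    proof (rule integral_mono)
      fix x assume "x \<in> space M"
      then show "r * (B \<theta> x powr (r - 1) * ((w t - w \<theta>) \<bullet> f x)) \<le> B t x powr r - B \<theta> x powr r"
        using powr_above_tangent[OF pos pos r, of \<theta> x t x] \<open>\<theta> \<in> T\<close> that
        by (simp add: B_def algebra_simps)
    qed (use diff_V[OF that] int \<open>\<theta> \<in> T\<close> that in \<open>auto simp: V_def\<close>)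
    also have "\<dots> = (\<integral>x. B t x powr r \<partial>M) - (\<integral>x. B \<theta> x powr r \<partial>M)"
      using int \<open>\<theta> \<in> T\<close> that by simp
    finally have "r * L (P (w t - w \<theta>)) \<le> (\<integral>x. B t x powr r \<partial>M) - (\<integral>x. B \<theta> x powr r \<partial>M)"
      using P(3) diff_V[OF that] by simp
    moreover have "L (P (w \<theta> - w \<theta>)) = 0"
      using linear_0[OF P(1)] by (simp add: L_def)
    ultimately show ?thesis by simp
  qed
  ultimately have "(\<lambda>v. F' v - r * L (P (w' v))) = (\<lambda>v. 0)"
    using differential_zero_maxmin[of \<theta> T ?\<phi>] \<open>open T\<close> \<open>\<theta> \<in> T\<close> by blast
  then have "F' v = r * L (P (w' v))" by (metis eq_iff_diff_eq_0)
  then show "F' v = r * (\<integral>x. B \<theta> x powr (r - 1) * (w' v \<bullet> f x) \<partial>M)"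
    using P(3) int' by (simp add: L_def V_def)
qed

section \<open>Vanishing integral of the gradient for alpha-exponential families\<close>

lemma power_familyE:
  assumes "power_family M r h w f \<Theta> p"
    and pos: "\<And>t x. t \<in> \<Theta> \<Longrightarrow> x \<in> space M \<Longrightarrow> 0 < p t x"
  obtains Z where "\<And>t. t \<in> \<Theta> \<Longrightarrow> Z differentiable (at t)" "\<And>t. t \<in> \<Theta> \<Longrightarrow> 0 < Z t"
    "\<And>t x. t \<in> \<Theta> \<Longrightarrow> x \<in> space M \<Longrightarrow> p t x = Z t * (h x + w t \<bullet> f x) powr r"
    "\<And>t x. t \<in> \<Theta> \<Longrightarrow> x \<in> space M \<Longrightarrow> 0 < h x + w t \<bullet> f x"
    "\<And>t. t \<in> \<Theta> \<Longrightarrow> w differentiable (at t)"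
    "\<And>t. t \<in> \<Theta> \<Longrightarrow> has_bochner_integral M (p t) 1"
proof -
  obtain Z where Z: "\<And>t. t \<in> \<Theta> \<Longrightarrow> Z differentiable (at t)"
    "\<And>t x. t \<in> \<Theta> \<Longrightarrow> x \<in> space M \<Longrightarrow> p t x = Z t * (h x + w t \<bullet> f x) powr r"
    using assms(1) unfolding power_family_def by fastforce
  have bi: "has_bochner_integral M (p t) 1" if "t \<in> \<Theta>" for t
    using assms(1) that by (auto simp: power_family_def prob_density_on_def)
  have "0 < Z t" if "t \<in> \<Theta>" for t
  proof -
    \<comment> \<open>Total mass 1 excludes an empty space, and positivity of the density at a
      single point already fixes the sign of \<open>Z t\<close>.\<close>
    have "space M \<noteq> {}"
      using has_bochner_integral_integral_eq[OF bi[OF that]]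
        Bochner_Integration.integral_empty[of M "p t"] by auto
    then obtain x where "x \<in> space M" by blast
    then have "0 < Z t * (h x + w t \<bullet> f x) powr r" using pos Z(2) that by metis
    then show ?thesis by (simp add: zero_less_mult_iff)
  qed
  then show thesis
    using assms(1) by (intro that[of Z] Z bi) (auto simp: power_family_def)
qed

lemma alpha_exponential_family_integral_grad:
  assumes "alpha_exponential_family M \<alpha> h w f \<Theta> p"
    and "0 < \<alpha>" "\<alpha> \<noteq> 1" "open \<Theta>" "\<theta> \<in> \<Theta>"
    and pos: "\<And>t x. t \<in> \<Theta> \<Longrightarrow> x \<in> space M \<Longrightarrow> 0 < p t x"
    and mutual: "mutual_integrals_defined M \<alpha> p \<Theta>"
    and int_grad: "integrable M (\<lambda>x. grad (\<lambda>t. p t x) \<theta>)"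
  shows "(\<integral>x. grad (\<lambda>t. p t x) \<theta> \<partial>M) = 0"
proof -
  define r where "r = 1 / (1 - \<alpha>)"
  define B where "B t x = h x + w t \<bullet> f x" for t x
  \<comment> \<open>The last two identities say that, up to constants,
    \<open>p \<theta> x powr \<alpha>\<close> is \<open>B \<theta> x powr (r - 1)\<close> and
    \<open>p t x powr (1 - \<alpha>)\<close> is \<open>B t x\<close>. Hence the mutual integrals are
    the mixed integrals of the convexity argument.\<close>
  have r: "1 \<le> r \<or> r \<le> 0" "r - 1 = r * \<alpha>" "r * (1 - \<alpha>) = 1"
    using assms(2,3) by (auto simp: r_def field_simps)
  have "power_family M r h w f \<Theta> p"
    using assms(1) by (simp add: alpha_exponential_family_def r_def)
  then obtain Z where Zd: "\<And>t. t \<in> \<Theta> \<Longrightarrow> Z differentiable (at t)" and Zpos: "\<And>t. t \<in> \<Theta> \<Longrightarrow> 0 < Z t"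
    and p: "\<And>t x. t \<in> \<Theta> \<Longrightarrow> x \<in> space M \<Longrightarrow> p t x = Z t * B t x powr r"
    and Bpos: "\<And>t x. t \<in> \<Theta> \<Longrightarrow> x \<in> space M \<Longrightarrow> 0 < B t x"
    and wd: "\<And>t. t \<in> \<Theta> \<Longrightarrow> w differentiable (at t)"
    and bi: "\<And>t. t \<in> \<Theta> \<Longrightarrow> has_bochner_integral M (p t) 1"
    using pos unfolding B_def by (rule power_familyE) blast+
  obtain w' where w': "(w has_derivative w') (at \<theta>)"
    using wd[OF \<open>\<theta> \<in> \<Theta>\<close>] by (auto simp: differentiable_def)
  obtain Z' where Z': "(Z has_derivative Z') (at \<theta>)"
    using Zd[OF \<open>\<theta> \<in> \<Theta>\<close>] by (auto simp: differentiable_def)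
  have bi_B: "has_bochner_integral M (\<lambda>x. B t x powr r) (1 / Z t)" if "t \<in> \<Theta>" for t
  proof -
    have "has_bochner_integral M (\<lambda>x. p t x / Z t) (1 / Z t)"
      using bi[OF that] by (rule has_bochner_integral_divide_zero)
    then show ?thesis
      by (rule has_bochner_integral_cong[THEN iffD1, rotated -1])
         (use p Zpos that in \<open>auto simp: less_imp_neq[THEN not_sym]\<close>)
  qed
  have mixed: "integrable M (\<lambda>x. B \<theta> x powr (r - 1) * B t x)" if t: "t \<in> \<Theta>" for t
  proof -
    have "integrable M (\<lambda>x. (p \<theta> x powr \<alpha> * p t x powr (1 - \<alpha>)) / (Z \<theta> powr \<alpha> * Z t powr (1 - \<alpha>)))"
      using mutual \<open>\<theta> \<in> \<Theta>\<close> t by (auto simp: mutual_integrals_defined_def)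
    then show ?thesis
    proof (rule Bochner_Integration.integrable_cong[THEN iffD1, rotated -1])
      fix x assume x: "x \<in> space M"
      have "p \<theta> x powr \<alpha> = Z \<theta> powr \<alpha> * B \<theta> x powr (r - 1)"
        using Zpos[OF \<open>\<theta> \<in> \<Theta>\<close>] p[OF \<open>\<theta> \<in> \<Theta>\<close> x] r(2) by (simp add: powr_mult powr_powr)
      moreover have "p t x powr (1 - \<alpha>) = Z t powr (1 - \<alpha>) * B t x"
        using Zpos[OF t] p[OF t x] Bpos[OF t x] r(3) by (simp add: powr_mult powr_powr)
      ultimately show "(p \<theta> x powr \<alpha> * p t x powr (1 - \<alpha>)) / (Z \<theta> powr \<alpha> * Z t powr (1 - \<alpha>))
          = B \<theta> x powr (r - 1) * B t x"
        using Zpos[OF t] Zpos[OF \<open>\<theta> \<in> \<Theta>\<close>] by simp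
    qed simp
  qed
  \<comment> \<open>Normalization makes the integral of \<open>B t x powr r\<close> equal to
    \<open>1 / Z t\<close> on \<open>\<Theta>\<close>. Its derivative is therefore known from that
    of \<open>Z\<close>, before any interchange with the integral.\<close>
  have "((\<lambda>t. 1 / Z t) has_derivative (\<lambda>v. - Z' v / (Z \<theta>)\<^sup>2)) (at \<theta>)"
    using Zpos[OF \<open>\<theta> \<in> \<Theta>\<close>]
    by (auto intro!: derivative_eq_intros Z' simp: fun_eq_iff power2_eq_square field_simps)
  then have F': "((\<lambda>t. \<integral>x. B t x powr r \<partial>M) has_derivative (\<lambda>v. - Z' v / (Z \<theta>)\<^sup>2)) (at \<theta>)"
    by (rule has_derivative_transform_within_open[OF _ \<open>open \<Theta>\<close> \<open>\<theta> \<in> \<Theta>\<close>])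
       (use bi_B has_bochner_integral_integral_eq in metis)
  have int_B: "integrable M (\<lambda>x. B t x powr r)" if "t \<in> \<Theta>" for t
    using bi_B[OF that] by (simp add: has_bochner_integral_iff)
  note F = integral_powr_affine_derivative[OF r(1) \<open>open \<Theta>\<close> \<open>\<theta> \<in> \<Theta>\<close>,
      of M h w f w', folded B_def, OF Bpos int_B mixed w' F']
  have "v \<bullet> (\<integral>x. grad (\<lambda>t. p t x) \<theta> \<partial>M) = 0" for v
  proof -
    have "v \<bullet> grad (\<lambda>t. p t x) \<theta>
        = Z' v * B \<theta> x powr r + Z \<theta> * (r * (B \<theta> x powr (r - 1) * (w' v \<bullet> f x)))"
      if x: "x \<in> space M" for x
    proof -
      have "((\<lambda>t. B t x) has_derivative (\<lambda>v. w' v \<bullet> f x)) (at \<theta>)"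
        unfolding B_def by (auto intro!: derivative_eq_intros w')
      moreover have "((\<lambda>y. y powr r) has_real_derivative r * B \<theta> x powr (r - 1)) (at (B \<theta> x))"
        using Bpos[OF \<open>\<theta> \<in> \<Theta>\<close> x] by (auto intro!: derivative_eq_intros)
      ultimately have "((\<lambda>t. B t x powr r) has_derivative
          (\<lambda>v. (w' v \<bullet> f x) * (r * B \<theta> x powr (r - 1)))) (at \<theta>)"
        by (rule DERIV_compose_FDERIV[rotated])
      from has_derivative_mult[OF Z' this]
      have D: "((\<lambda>t. p t x) has_derivative (\<lambda>v. Z \<theta> * ((w' v \<bullet> f x) * (r * B \<theta> x powr (r - 1)))
            + Z' v * B \<theta> x powr r)) (at \<theta>)"
        by (rule has_derivative_transform_within_open[OF _ \<open>open \<Theta>\<close> \<open>\<theta> \<in> \<Theta>\<close>]) (use p x in auto)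
      then have "(\<lambda>t. p t x) differentiable (at \<theta>)" by (auto simp: differentiable_def)
      then have "((\<lambda>t. p t x) has_derivative (\<lambda>v. v \<bullet> grad (\<lambda>t. p t x) \<theta>)) (at \<theta>)"
        using differentiable_imp_GDERIV_grad unfolding gderiv_def by blast
      from has_derivative_unique[OF this D] show ?thesis
        by (simp add: fun_eq_iff ac_simps)
    qed
    then have "(\<integral>x. v \<bullet> grad (\<lambda>t. p t x) \<theta> \<partial>M)
        = (\<integral>x. Z' v * B \<theta> x powr r + Z \<theta> * (r * (B \<theta> x powr (r - 1) * (w' v \<bullet> f x))) \<partial>M)"
      by (intro Bochner_Integration.integral_cong) auto
    also have "\<dots> = Z' v * (\<integral>x. B \<theta> x powr r \<partial>M)
        + Z \<theta> * (r * (\<integral>x. B \<theta> x powr (r - 1) * (w' v \<bullet> f x) \<partial>M))"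
      using int_B[OF \<open>\<theta> \<in> \<Theta>\<close>] F(1)[of v] by simp
    \<comment> \<open>The variation of the normalizing factor and the variation of the power
      cancel.\<close>
    also have "\<dots> = Z' v * (1 / Z \<theta>) + Z \<theta> * (- Z' v / (Z \<theta>)\<^sup>2)"
      using F(2)[of v] has_bochner_integral_integral_eq[OF bi_B[OF \<open>\<theta> \<in> \<Theta>\<close>]] by simp
    also have "\<dots> = 0"
      using Zpos[OF \<open>\<theta> \<in> \<Theta>\<close>] by (simp add: power2_eq_square)
    finally show ?thesis using int_grad by simp
  qed
  then show ?thesis using inner_eq_zero_iff by blast
qed

lemma mutual_integrals_defined_less_1:
  assumes "0 < \<alpha>" "\<alpha> < 1"
    and pos: "\<And>t x. t \<in> \<Theta> \<Longrightarrow> x \<in> space M \<Longrightarrow> 0 < p t x"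
    and int: "\<And>t. t \<in> \<Theta> \<Longrightarrow> integrable M (p t)"
  shows "mutual_integrals_defined M \<alpha> p \<Theta>"
  unfolding mutual_integrals_defined_def
proof (intro ballI)
  fix t t' assume t: "t \<in> \<Theta>" "t' \<in> \<Theta>"
  have [measurable]: "p t \<in> borel_measurable M" "p t' \<in> borel_measurable M"
    using int t by auto
  show "integrable M (\<lambda>x. p t' x powr \<alpha> * p t x powr (1 - \<alpha>))"
  proof (rule Bochner_Integration.integrable_bound[of _ "\<lambda>x. p t' x + p t x"])
    show "AE x in M. norm (p t' x powr \<alpha> * p t x powr (1 - \<alpha>)) \<le> norm (p t' x + p t x)"
    proof (rule AE_I2)
      fix x assume "x \<in> space M"
      then have "0 < p t' x" "0 < p t x" using pos t by auto
      then show "norm (p t' x powr \<alpha> * p t x powr (1 - \<alpha>)) \<le> norm (p t' x + p t x)"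
        using powr_mult_powr_le_add[of "p t' x" "p t x" \<alpha>] assms(1,2) by simp
    qed
  qed (use int t in auto)
qed

section \<open>Scores of densities and of their escort densities\<close>

lemma score_GDERIV:
  fixes p :: "'t::euclidean_space \<Rightarrow> 'x \<Rightarrow> real"
  assumes "score_defined M p \<theta>" "x \<in> space M"
  shows "GDERIV (\<lambda>t. ln (p t x)) \<theta> :> score p \<theta> x"
  using assms differentiable_imp_GDERIV_grad by (auto simp: score_defined_def score_def)

text \<open>A defined score gives differentiability of the logarithm only. The density is recovered
  as its exponential, the two agreeing on the open set \<open>\<Theta>\<close> by
  positivity.\<close>

lemma GDERIV_density:
  fixes p :: "'t::euclidean_space \<Rightarrow> 'x \<Rightarrow> real"
  assumes "score_defined M p \<theta>" "x \<in> space M" "open \<Theta>" "\<theta> \<in> \<Theta>"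
    and pos: "\<And>t. t \<in> \<Theta> \<Longrightarrow> 0 < p t x"
  shows "GDERIV (\<lambda>t. p t x) \<theta> :> p \<theta> x *\<^sub>R score p \<theta> x"
proof (rule GDERIV_cong_open[OF _ \<open>open \<Theta>\<close> \<open>\<theta> \<in> \<Theta>\<close>])
  have "(exp has_real_derivative p \<theta> x) (at (ln (p \<theta> x)))"
    using DERIV_exp[of "ln (p \<theta> x)"] pos[OF \<open>\<theta> \<in> \<Theta>\<close>] by simp
  from GDERIV_DERIV_compose[OF score_GDERIV[OF assms(1,2)] this]
  show "GDERIV (\<lambda>t. exp (ln (p t x))) \<theta> :> p \<theta> x *\<^sub>R score p \<theta> x" .
qed (use pos in auto)

text \<open>At each \<open>x\<close>, the logarithm of the escort normalizer is
  \<open>\<alpha> * ln (p t x)\<close> minus the logarithm of the escort density. Its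
  differentiability thus follows from the two scores being defined, and its gradient
  \<open>c\<close> is the same for all \<open>x\<close>.\<close>

lemma score_escort:
  fixes p :: "'t::euclidean_space \<Rightarrow> 'x \<Rightarrow> real"
  assumes "open \<Theta>" "\<theta> \<in> \<Theta>"
    and pos: "\<And>t x. t \<in> \<Theta> \<Longrightarrow> x \<in> space M \<Longrightarrow> 0 < p t x"
    and N: "\<And>t. t \<in> \<Theta> \<Longrightarrow> 0 < (\<integral>x. p t x powr \<alpha> \<partial>M)"
    and sp: "score_defined M p \<theta>" and sq: "score_defined M (\<lambda>t. escort M \<alpha> (p t)) \<theta>"
  obtains c where "\<And>x. x \<in> space M \<Longrightarrow> score (\<lambda>t. escort M \<alpha> (p t)) \<theta> x = \<alpha> *\<^sub>R score p \<theta> x - c"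
proof
  let ?q = "\<lambda>t. escort M \<alpha> (p t)"
  fix x assume x: "x \<in> space M"
  have "GDERIV (\<lambda>t. \<alpha> * ln (p t x) - ln (?q t x)) \<theta> :> \<alpha> *\<^sub>R score p \<theta> x - score ?q \<theta> x"
  proof -
    have "((\<lambda>t. \<alpha> * ln (p t x) - ln (?q t x)) has_derivative
        (\<lambda>h. \<alpha> * (h \<bullet> score p \<theta> x) - h \<bullet> score ?q \<theta> x)) (at \<theta>)"
      using score_GDERIV[OF sp x] score_GDERIV[OF sq x] unfolding gderiv_def
      by (intro has_derivative_diff has_derivative_mult_right)
    then show ?thesis by (simp add: gderiv_def inner_diff_right)
  qed
  then have "GDERIV (\<lambda>t. ln (\<integral>x. p t x powr \<alpha> \<partial>M)) \<theta> :> \<alpha> *\<^sub>R score p \<theta> x - score ?q \<theta> x"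
    by (rule GDERIV_cong_open[OF _ \<open>open \<Theta>\<close> \<open>\<theta> \<in> \<Theta>\<close>])
       (use pos[OF _ x] N in \<open>force simp: escort_def ln_div ln_powr dest: less_imp_neq\<close>)
  then show "score ?q \<theta> x
      = \<alpha> *\<^sub>R score p \<theta> x - grad (\<lambda>t. ln (\<integral>x. p t x powr \<alpha> \<partial>M)) \<theta>"
    by (simp add: GDERIV_imp_grad_eq)
qed

text \<open>\<open>powr\<close> is nonnegative and vanishes only at base 0, so a zero integral would
  force \<open>g\<close> to vanish almost everywhere. With \<open>k = 1\<close> this makes escort
  normalizers positive; with a power of the density as \<open>k\<close> it keeps the Jones
  denominator away from zero.\<close>

lemma integral_mult_powr_pos:
  fixes g k :: "'x \<Rightarrow> real"
  assumes "integrable M (\<lambda>x. g x powr \<alpha> * k x)" "\<And>x. x \<in> space M \<Longrightarrow> 0 < k x"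
    and "\<not> (AE x in M. g x = 0)"
  shows "0 < (\<integral>x. g x powr \<alpha> * k x \<partial>M)"
proof -
  have nn: "AE x in M. 0 \<le> g x powr \<alpha> * k x"
    using assms(2) by (intro AE_I2) (simp add: less_imp_le)
  have "(\<integral>x. g x powr \<alpha> * k x \<partial>M) \<noteq> 0"
  proof
    assume "(\<integral>x. g x powr \<alpha> * k x \<partial>M) = 0"
    then have "AE x in M. g x powr \<alpha> * k x = 0"
      using integral_nonneg_eq_0_iff_AE[OF assms(1) nn] by simp
    then have "AE x in M. g x = 0"
    proof (rule AE_mp, intro AE_I2 impI)
      fix x assume "x \<in> space M" "g x powr \<alpha> * k x = 0"
      then show "g x = 0" using assms(2)[of x] by simp
    qed
    then show False using assms(3) by blast
  qed
  then show ?thesis using integral_nonneg_AE[OF nn] by linarith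
qed

section \<open>Equivalence of the two estimating equations\<close>

text \<open>\<open>zero\<close> is stated as an implication because integrability of the gradient is
  obtained inside the proof, from the definedness of the Jones integrals. This form can be supplied
  in both the discrete and the continuous case.\<close>

lemma jones_equation_escort_iff:
  fixes p :: "real^'k \<Rightarrow> 'x \<Rightarrow> real"
  assumes "0 < \<alpha>" "open \<Theta>" "\<theta> \<in> \<Theta>"
    and pos: "\<And>t x. t \<in> \<Theta> \<Longrightarrow> x \<in> space M \<Longrightarrow> 0 < p t x"
    and N: "\<And>t. t \<in> \<Theta> \<Longrightarrow> 0 < (\<integral>x. p t x powr \<alpha> \<partial>M)"
    and p1: "has_bochner_integral M (p \<theta>) 1"
    and g: "escort_defined M \<alpha> g" "\<not> (AE x in M. g x = 0)"
    and hd: "hellinger_defined M \<alpha> p g \<theta>"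
    and jd: "jones_defined M (1 / \<alpha>) (\<lambda>t. escort M \<alpha> (p t)) (escort M \<alpha> g) \<theta>"
    and zero: "integrable M (\<lambda>x. grad (\<lambda>t. p t x) \<theta>) \<Longrightarrow> (\<integral>x. grad (\<lambda>t. p t x) \<theta> \<partial>M) = 0"
  shows "jones_equation M (1 / \<alpha>) (\<lambda>t. escort M \<alpha> (p t)) (escort M \<alpha> g) \<theta>
    \<longleftrightarrow> hellinger_equation M \<alpha> p g \<theta>"
proof -
  define s where "s = score p \<theta>"
  define q where "q = (\<lambda>t. escort M \<alpha> (p t))"
  define G where "G = (\<integral>x. g x powr \<alpha> \<partial>M)"
  \<comment> \<open>\<open>n\<close> and \<open>m\<close> are the powers of the escort normalizer
    that appear when \<open>q \<theta> x\<close> is raised to \<open>1 / \<alpha> - 1\<close> and to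
    \<open>1 / \<alpha>\<close>.\<close>
  define n where "n = (\<integral>x. p \<theta> x powr \<alpha> \<partial>M) powr (1 / \<alpha> - 1)"
  define m where "m = (\<integral>x. p \<theta> x powr \<alpha> \<partial>M) powr (1 / \<alpha>)"
  define k where "k x = g x powr \<alpha> * p \<theta> x powr (1 - \<alpha>)" for x
  have sp: "score_defined M p \<theta>" and sq: "score_defined M q \<theta>"
    and int_ks: "integrable M (\<lambda>x. k x *\<^sub>R s x)"
    using hd jd by (simp_all add: hellinger_defined_def jones_defined_def k_def s_def q_def)
  obtain c where c: "\<And>x. x \<in> space M \<Longrightarrow> score q \<theta> x = \<alpha> *\<^sub>R s x - c"
    unfolding s_def q_def
    using score_escort[OF \<open>open \<Theta>\<close> \<open>\<theta> \<in> \<Theta>\<close> pos N sp sq[unfolded q_def]] by blast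
  have "n > 0" "m > 0" using N[OF \<open>\<theta> \<in> \<Theta>\<close>] by (auto simp: n_def m_def)
  have "integrable M (\<lambda>x. g x powr \<alpha> * 1)" using g by (simp add: escort_defined_def)
  then have "G > 0"
    using integral_mult_powr_pos[of M g \<alpha> "\<lambda>x. 1"] g(2) by (simp add: G_def)
  have gq: "escort M \<alpha> g x * q \<theta> x powr (1 / \<alpha> - 1) = inverse (G * n) * k x"
    if "x \<in> space M" for x
  proof -
    have "q \<theta> x powr (1 / \<alpha> - 1) = p \<theta> x powr (1 - \<alpha>) / n"
      using pos[OF \<open>\<theta> \<in> \<Theta>\<close> that] N[OF \<open>\<theta> \<in> \<Theta>\<close>] \<open>0 < \<alpha>\<close>
      by (simp add: q_def escort_def n_def powr_divide powr_powr right_diff_distrib)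
    then show ?thesis by (simp add: escort_def k_def G_def divide_inverse ac_simps)
  qed
  have q: "q \<theta> x powr (1 / \<alpha>) = inverse m * p \<theta> x" if "x \<in> space M" for x
    using pos[OF \<open>\<theta> \<in> \<Theta>\<close> that] N[OF \<open>\<theta> \<in> \<Theta>\<close>] \<open>0 < \<alpha>\<close>
    by (simp add: q_def escort_def m_def powr_divide powr_powr divide_inverse[of "p \<theta> x"] ac_simps)
  \<comment> \<open>Definedness of the Hellinger equation covers \<open>k\<close> times the score
    only; integrability of \<open>k\<close> itself is read off from the Jones denominator.\<close>
  have "integrable M (\<lambda>x. escort M \<alpha> g x * q \<theta> x powr (1 / \<alpha> - 1))"
    using jd by (simp add: jones_defined_def q_def)
  then have "integrable M (\<lambda>x. inverse (G * n) * k x)"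
    by (rule Bochner_Integration.integrable_cong[THEN iffD1, rotated -1]) (simp_all add: gq)
  then have int_k: "integrable M k"
    using \<open>G > 0\<close> \<open>n > 0\<close> by simp
  then have k_pos: "0 < (\<integral>x. k x \<partial>M)"
    using integral_mult_powr_pos[of M g \<alpha> "\<lambda>x. p \<theta> x powr (1 - \<alpha>)"] pos[OF \<open>\<theta> \<in> \<Theta>\<close>] g(2)
    unfolding k_def by fastforce
  have int_p: "integrable M (p \<theta>)" and p_1: "(\<integral>x. p \<theta> x \<partial>M) = 1"
    using p1 by (auto simp: has_bochner_integral_iff)
  have int_ps: "integrable M (\<lambda>x. p \<theta> x *\<^sub>R s x)"
  proof -
    have "integrable M (\<lambda>x. q \<theta> x powr (1 / \<alpha>) *\<^sub>R score q \<theta> x)"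
      using jd by (simp add: jones_defined_def q_def)
    \<comment> \<open>The score relation solved for \<open>s\<close>: adding back the multiple of
      \<open>c\<close> costs only integrability of the density.\<close>
    then have "integrable M (\<lambda>x. (m / \<alpha>) *\<^sub>R (q \<theta> x powr (1 / \<alpha>) *\<^sub>R score q \<theta> x)
        + (1 / \<alpha>) *\<^sub>R (p \<theta> x *\<^sub>R c))"
      using int_p by (intro Bochner_Integration.integrable_add integrable_scaleR_right integrable_scaleR_left)
    then show ?thesis
      by (rule Bochner_Integration.integrable_cong[THEN iffD1, rotated -1])
         (use \<open>m > 0\<close> \<open>0 < \<alpha>\<close> in \<open>auto simp: q c scaleR_diff_right mult.assoc[symmetric]\<close>)
  qed
  have grad_p: "grad (\<lambda>t. p t x) \<theta> = p \<theta> x *\<^sub>R s x" if "x \<in> space M" for x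
    using GDERIV_density[OF sp that \<open>open \<Theta>\<close> \<open>\<theta> \<in> \<Theta>\<close>] pos that
    by (simp add: GDERIV_imp_grad_eq s_def)
  have ps_0: "(\<integral>x. p \<theta> x *\<^sub>R s x \<partial>M) = 0"
  proof -
    have "integrable M (\<lambda>x. grad (\<lambda>t. p t x) \<theta>)"
      using int_ps by (simp add: grad_p cong: Bochner_Integration.integrable_cong)
    from zero[OF this] show ?thesis
      by (simp add: grad_p cong: Bochner_Integration.integral_cong)
  qed
  \<comment> \<open>Serves both numerators of the Jones equation: the shift \<open>c\<close> comes
    out multiplied by the total weight.\<close>
  have weighted: "(\<integral>x. u x *\<^sub>R score q \<theta> x \<partial>M)
      = a *\<^sub>R (\<alpha> *\<^sub>R (\<integral>x. v x *\<^sub>R s x \<partial>M) - (\<integral>x. v x \<partial>M) *\<^sub>R c)"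
    if "\<And>x. x \<in> space M \<Longrightarrow> u x = a * v x" "integrable M v" "integrable M (\<lambda>x. v x *\<^sub>R s x)"
    for u v :: "'x \<Rightarrow> real" and a
  proof -
    have "(\<integral>x. u x *\<^sub>R score q \<theta> x \<partial>M) = (\<integral>x. a *\<^sub>R (\<alpha> *\<^sub>R (v x *\<^sub>R s x) - v x *\<^sub>R c) \<partial>M)"
      by (rule Bochner_Integration.integral_cong) (simp_all add: that(1) c scaleR_diff_right mult.left_commute)
    then show ?thesis using that(2,3) by (simp del: scaleR_scaleR)
  qed
  let ?H = "\<integral>x. k x *\<^sub>R s x \<partial>M" and ?K = "\<integral>x. k x \<partial>M"
  have "(\<integral>x. (escort M \<alpha> g x * q \<theta> x powr (1 / \<alpha> - 1)) *\<^sub>R score q \<theta> x \<partial>M)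
      /\<^sub>R (\<integral>x. escort M \<alpha> g x * q \<theta> x powr (1 / \<alpha> - 1) \<partial>M) = (\<alpha> / ?K) *\<^sub>R ?H - c"
  proof -
    have "(\<integral>x. escort M \<alpha> g x * q \<theta> x powr (1 / \<alpha> - 1) \<partial>M) = inverse (G * n) * ?K"
      by (simp add: gq cong: Bochner_Integration.integral_cong)
    moreover have "(\<integral>x. (escort M \<alpha> g x * q \<theta> x powr (1 / \<alpha> - 1)) *\<^sub>R score q \<theta> x \<partial>M)
        = inverse (G * n) *\<^sub>R (\<alpha> *\<^sub>R ?H - ?K *\<^sub>R c)"
      by (rule weighted[OF _ int_k int_ks]) (rule gq)
    \<comment> \<open>Division by the total weight removes the scale \<open>a\<close> and turns the
      shift into exactly \<open>- c\<close>, as on the other side of the equation.\<close>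
    moreover have "(a *\<^sub>R (\<alpha> *\<^sub>R ?H - ?K *\<^sub>R c)) /\<^sub>R (a * ?K) = (\<alpha> / ?K) *\<^sub>R ?H - c"
      if "a \<noteq> 0" for a
      using that k_pos by (simp add: scaleR_diff_right inverse_eq_divide)
    moreover have "inverse (G * n) \<noteq> 0" using \<open>G > 0\<close> \<open>n > 0\<close> by simp
    ultimately show ?thesis by (simp only: simp_thms)
  qed
  moreover have "(\<integral>x. q \<theta> x powr (1 / \<alpha>) *\<^sub>R score q \<theta> x \<partial>M)
      /\<^sub>R (\<integral>x. q \<theta> x powr (1 / \<alpha>) \<partial>M) = - c"
  proof -
    have "(\<integral>x. q \<theta> x powr (1 / \<alpha>) \<partial>M) = inverse m"
      by (simp add: q p_1 cong: Bochner_Integration.integral_cong)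
    moreover have "(\<integral>x. q \<theta> x powr (1 / \<alpha>) *\<^sub>R score q \<theta> x \<partial>M)
        = inverse m *\<^sub>R (\<alpha> *\<^sub>R (\<integral>x. p \<theta> x *\<^sub>R s x \<partial>M) - (\<integral>x. p \<theta> x \<partial>M) *\<^sub>R c)"
      by (rule weighted[OF _ int_p int_ps]) (rule q)
    ultimately show ?thesis
      using \<open>m > 0\<close> by (simp add: ps_0 p_1)
  qed
  ultimately have "jones_equation M (1 / \<alpha>) q (escort M \<alpha> g) \<theta> \<longleftrightarrow> (\<alpha> / ?K) *\<^sub>R ?H - c = - c"
    by (simp add: jones_equation_def)
  also have "\<dots> \<longleftrightarrow> ?H = 0" using k_pos \<open>0 < \<alpha>\<close> by simp
  finally show ?thesis by (simp add: hellinger_equation_def q_def k_def s_def)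
qed

section \<open>The escort densities form an M-family\<close>

text \<open>Taking the power \<open>\<alpha>\<close> multiplies the exponent \<open>r\<close> by
  \<open>\<alpha>\<close>, which gives \<open>1 / (1 / \<alpha> - 1)\<close>, and leaves the base
  alone, so \<open>h\<close>, \<open>w\<close> and \<open>f\<close> carry over. The work lies in the
  differentiability of the new normalizing factor.\<close>

lemma M_family_escort:
  assumes fam: "alpha_exponential_family M \<alpha> h w f \<Theta> p"
    and "0 < \<alpha>" "\<alpha> \<noteq> 1" "open \<Theta>" "x0 \<in> space M"
    and pos: "\<And>t x. t \<in> \<Theta> \<Longrightarrow> x \<in> space M \<Longrightarrow> 0 < p t x"
    and int: "\<And>t. t \<in> \<Theta> \<Longrightarrow> escort_defined M \<alpha> (p t)"
    and N: "\<And>t. t \<in> \<Theta> \<Longrightarrow> 0 < (\<integral>x. p t x powr \<alpha> \<partial>M)"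
    and sq: "\<And>t. t \<in> \<Theta> \<Longrightarrow> score_defined M (\<lambda>t. escort M \<alpha> (p t)) t"
  shows "M_family M (1 / \<alpha>) h w f \<Theta> (\<lambda>t. escort M \<alpha> (p t))"
proof -
  define r where "r = 1 / (1 - \<alpha>)"
  define B where "B t x = h x + w t \<bullet> f x" for t x
  let ?q = "\<lambda>t. escort M \<alpha> (p t)"
  have r: "1 / (1 / \<alpha> - 1) = r * \<alpha>"
    using assms(2,3) by (auto simp: r_def field_simps)
  have fam': "power_family M r h w f \<Theta> p"
    using fam by (simp add: alpha_exponential_family_def r_def)
  then obtain Z where Zpos: "\<And>t. t \<in> \<Theta> \<Longrightarrow> 0 < Z t"
    and p: "\<And>t x. t \<in> \<Theta> \<Longrightarrow> x \<in> space M \<Longrightarrow> p t x = Z t * B t x powr r"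
    and Bpos: "\<And>t x. t \<in> \<Theta> \<Longrightarrow> x \<in> space M \<Longrightarrow> 0 < B t x"
    and wd: "\<And>t. t \<in> \<Theta> \<Longrightarrow> w differentiable (at t)"
    using pos unfolding B_def by (rule power_familyE) blast+
  have p0: "p t x = 0" if "t \<in> \<Theta>" "x \<notin> space M" for t x
    using fam' that by (auto simp: power_family_def prob_density_on_def)
  have qpos: "0 < ?q t x" if "t \<in> \<Theta>" "x \<in> space M" for t x
    using pos[OF that] N[OF that(1)] by (simp add: escort_def)
  have q: "?q t x = Z t powr \<alpha> / (\<integral>x. p t x powr \<alpha> \<partial>M) * B t x powr (r * \<alpha>)"
    if "t \<in> \<Theta>" "x \<in> space M" for t x
    using that Zpos[OF that(1)] p[OF that] by (simp add: escort_def powr_mult powr_powr)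
  \<comment> \<open>The normalizing factor, read off at \<open>x0\<close>: its differentiability then comes from the score.\<close>
  define Y where "Y t = ?q t x0 * B t x0 powr - (r * \<alpha>)" for t
  have Y: "Y t = Z t powr \<alpha> / (\<integral>x. p t x powr \<alpha> \<partial>M)" if "t \<in> \<Theta>" for t
    using q[OF that \<open>x0 \<in> space M\<close>] Bpos[OF that \<open>x0 \<in> space M\<close>]
    by (simp add: Y_def powr_minus)
  have "Y differentiable (at t)" if t: "t \<in> \<Theta>" for t
  proof -
    have "(\<lambda>t. ?q t x0) differentiable (at t)"
      using GDERIV_density[OF sq[OF t] \<open>x0 \<in> space M\<close> \<open>open \<Theta>\<close> t] qpos \<open>x0 \<in> space M\<close>
      by (auto simp: gderiv_def differentiable_def)
    moreover have "(\<lambda>t. B t x0 powr - (r * \<alpha>)) differentiable (at t)"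
    proof -
      obtain w' where w': "(w has_derivative w') (at t)"
        using wd[OF t] by (auto simp: differentiable_def)
      have "((\<lambda>t. B t x0) has_derivative (\<lambda>v. w' v \<bullet> f x0)) (at t)"
        unfolding B_def by (auto intro!: derivative_eq_intros w')
      moreover have "((\<lambda>y. y powr - (r * \<alpha>)) has_real_derivative
          - (r * \<alpha>) * B t x0 powr (- (r * \<alpha>) - 1)) (at (B t x0))"
        using Bpos[OF t \<open>x0 \<in> space M\<close>] by (auto intro!: derivative_eq_intros)
      ultimately have "((\<lambda>t. B t x0 powr - (r * \<alpha>)) has_derivative
          (\<lambda>v. (w' v \<bullet> f x0) * (- (r * \<alpha>) * B t x0 powr (- (r * \<alpha>) - 1)))) (at t)"
        by (rule DERIV_compose_FDERIV[rotated])
      then show ?thesis by (auto simp: differentiable_def)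
    qed
    ultimately show ?thesis unfolding Y_def by (rule differentiable_mult)
  qed
  moreover have "?q t x = (if x \<in> space M then Y t * B t x powr (r * \<alpha>) else 0)" if "t \<in> \<Theta>" for t x
    using q[OF that] Y[OF that] p0[OF that] by (auto simp: escort_def)
  moreover have "prob_density_on M (?q t)" if "t \<in> \<Theta>" for t
  proof -
    have "has_bochner_integral M (?q t) 1"
      using N[OF that] int[OF that]
      by (simp add: has_bochner_integral_iff escort_def[abs_def] escort_defined_def)
    moreover have "0 \<le> ?q t x" for x
      using N[OF that] by (simp add: escort_def)
    ultimately show ?thesis
      using p0[OF that] by (simp add: prob_density_on_def) (simp add: escort_def)
  qed
  ultimately show ?thesis
    using wd Bpos unfolding M_family_def power_family_def r B_def by blast
qed

section \<open>Combination of the discrete and continuous cases\<close>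

theorem corollary9:
  fixes h :: "real^'d \<Rightarrow> real"
    and f :: "real^'d \<Rightarrow> real^'s"
    and w :: "real^'k \<Rightarrow> real^'s"
    and \<Theta> :: "(real^'k) set"
    and S :: "(real^'d) set"
    and M :: "(real^'d) measure"
    and p :: "real^'k \<Rightarrow> real^'d \<Rightarrow> real"
    and g :: "real^'d \<Rightarrow> real"
    and X :: "nat \<Rightarrow> real^'d"
    and n :: nat
    and \<alpha> :: real
  assumes "0 < \<alpha>" and "\<alpha> \<noteq> 1"
    and "open \<Theta>"
    and "0 < n" and "\<forall>i<n. X i \<in> S"
    and cases:
      "(countable S \<and> M = count_space S \<and> g = empirical n X \<and>
          (infinite S \<and> 1 < \<alpha> \<longrightarrow> mutual_integrals_defined M \<alpha> p \<Theta>)) \<or>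
       (S \<in> sets lebesgue \<and> M = lebesgue_on S \<and> prob_density_on M g \<and>
          (\<forall>\<theta>\<in>\<Theta>. has_bochner_integral M (\<lambda>x. grad (\<lambda>t. p t x) \<theta>) 0))"
    and "alpha_exponential_family M \<alpha> h w f \<Theta> p"
    and "\<forall>\<theta>\<in>\<Theta>. {x. 0 < p \<theta> x} = S"
    and "\<forall>\<theta>\<in>\<Theta>. escort_defined M \<alpha> (p \<theta>)"
    and "escort_defined M \<alpha> g"
    and "\<forall>\<theta>\<in>\<Theta>. hellinger_defined M \<alpha> p g \<theta>"
    and "\<forall>\<theta>\<in>\<Theta>. jones_defined M (1 / \<alpha>) (\<lambda>t. escort M \<alpha> (p t)) (escort M \<alpha> g) \<theta>"
  shows "M_family M (1 / \<alpha>) h w f \<Theta> (\<lambda>\<theta>. escort M \<alpha> (p \<theta>)) \<and>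
         (\<forall>\<theta>\<in>\<Theta>. hellinger_equation M \<alpha> p g \<theta> \<longleftrightarrow>
           jones_equation M (1 / \<alpha>) (\<lambda>t. escort M \<alpha> (p t)) (escort M \<alpha> g) \<theta>)"
proof -
  have fam: "alpha_exponential_family M \<alpha> h w f \<Theta> p" by fact
  have sp: "space M = S" using cases by auto
  \<comment> \<open>This sample point is used twice: as a point carrying empirical mass and as the
    place where the normalizing factor is read off.\<close>
  have "X 0 \<in> S" using \<open>0 < n\<close> \<open>\<forall>i<n. X i \<in> S\<close> by blast
  have pos: "0 < p t x" if "t \<in> \<Theta>" "x \<in> space M" for t x
    using that sp \<open>\<forall>\<theta>\<in>\<Theta>. {x. 0 < p \<theta> x} = S\<close> by blast
  have p1: "has_bochner_integral M (p t) 1" if "t \<in> \<Theta>" for t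
    using fam that
    by (auto simp: alpha_exponential_family_def power_family_def prob_density_on_def)
  have not_AE_0: "\<not> (AE x in M. u x = 0)" if "has_bochner_integral M u 1" for u :: "real^'d \<Rightarrow> real"
    using that by (auto simp: has_bochner_integral_iff dest: integral_eq_zero_AE)
  have N: "0 < (\<integral>x. p t x powr \<alpha> \<partial>M)" if "t \<in> \<Theta>" for t
    using integral_mult_powr_pos[of M "p t" \<alpha> "\<lambda>x. 1"] not_AE_0[OF p1[OF that]]
      \<open>\<forall>\<theta>\<in>\<Theta>. escort_defined M \<alpha> (p \<theta>)\<close> that
    by (simp add: escort_defined_def)
  have g: "\<not> (AE x in M. g x = 0)"
    using cases
  proof
    assume "countable S \<and> M = count_space S \<and> g = empirical n X \<and>
      (infinite S \<and> 1 < \<alpha> \<longrightarrow> mutual_integrals_defined M \<alpha> p \<Theta>)"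
    then have M: "M = count_space S" and g: "g = empirical n X" by auto
    \<comment> \<open>Index 0 gives \<open>X 0\<close> positive empirical mass, and no point of
      \<open>S\<close> is null for counting measure.\<close>
    have "0 \<in> {i. i < n \<and> X i = X 0}" using \<open>0 < n\<close> by simp
    then have "card {i. i < n \<and> X i = X 0} \<noteq> 0" by (subst card_0_eq) auto
    then have "g (X 0) \<noteq> 0" using \<open>0 < n\<close> by (simp add: g empirical_def)
    then show ?thesis using \<open>X 0 \<in> S\<close> unfolding M AE_count_space by blast
  qed (use not_AE_0 in \<open>unfold prob_density_on_def, blast\<close>)
  have zero: "(\<integral>x. grad (\<lambda>t. p t x) \<theta> \<partial>M) = 0"
    if "\<theta> \<in> \<Theta>" "integrable M (\<lambda>x. grad (\<lambda>t. p t x) \<theta>)" for \<theta>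
    using cases
  proof
    assume *: "countable S \<and> M = count_space S \<and> g = empirical n X \<and>
      (infinite S \<and> 1 < \<alpha> \<longrightarrow> mutual_integrals_defined M \<alpha> p \<Theta>)"
    have "mutual_integrals_defined M \<alpha> p \<Theta>"
    proof -
      \<comment> \<open>Domination settles the first case and finiteness the second; the third is
        where the mutual integrals are assumed.\<close>
      consider "\<alpha> < 1" | "finite S" | "infinite S" "1 < \<alpha>"
        using \<open>\<alpha> \<noteq> 1\<close> by linarith
      then show ?thesis
      proof cases
        case 1
        then show ?thesis
          using \<open>0 < \<alpha>\<close> pos p1
          by (intro mutual_integrals_defined_less_1) (auto simp: has_bochner_integral_iff)
      next
        case 2
        then show ?thesis
          using * by (auto simp: mutual_integrals_defined_def intro: integrable_count_space)
      qed (use * in blast)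
    qed
    then show ?thesis
      using alpha_exponential_family_integral_grad[OF fam] assms(1-3) that pos by blast
  qed (use that in \<open>auto dest: has_bochner_integral_integral_eq\<close>)
  have jd: "jones_defined M (1 / \<alpha>) (\<lambda>t. escort M \<alpha> (p t)) (escort M \<alpha> g) t" if "t \<in> \<Theta>" for t
    using assms that by blast
  have "M_family M (1 / \<alpha>) h w f \<Theta> (\<lambda>\<theta>. escort M \<alpha> (p \<theta>))"
    by (rule M_family_escort[OF fam assms(1-3), of "X 0"])
       (use \<open>X 0 \<in> S\<close> sp pos N jd assms in \<open>auto simp: jones_defined_def\<close>)
  moreover have "hellinger_equation M \<alpha> p g \<theta> \<longleftrightarrow>
      jones_equation M (1 / \<alpha>) (\<lambda>t. escort M \<alpha> (p t)) (escort M \<alpha> g) \<theta>" if "\<theta> \<in> \<Theta>" for \<theta>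
    by (rule jones_equation_escort_iff[OF \<open>0 < \<alpha>\<close> \<open>open \<Theta>\<close> that, symmetric])
       (use that pos N p1 g jd zero assms in blast)+
  ultimately show ?thesis by blast
qed

end
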